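(* Let $G_1,\dots,G_m$ be cumulative distribution functions and let $H_{G_1,\dots,G_m}$ be a cumulative distribution function generated from $G_1,\dots,G_m$ by Form A (respectively, by Form B), as defined in the context. Write $\Phi=F$ and $N=n$ in the case of Form A, and $\Phi=\varphi$ and $N=\eta$ in the case of Form B. Assume: (f1) $S_\Phi$ is a convex set; (f2) at least one of the following holds: (a) $\mu_N(1,\dots,1)=\sup\{x\in\mathbb{R}:\Phi(x)<1\}$, $\ell_1(1,\dots,1)=\inf\{x\in\mathbb{R}:\Phi(x)>0\}$, $\mathcal U(.)(x)>0$ for all $x\in\mathbb{R}$, and for some $j\in\{1,\dots,N\}$ at least one of $\mu_j$, $\ell_j$ is strictly monotonic; (b) $\nu_N(0,\dots,0)=\sup\{x\in\mathbb{R}:\Phi(x)<1\}$, $m_1(0,\dots,0)=\inf\{x\in\mathbb{R}:\Phi(x)>0\}$, $\vartheta(.)(x)>0$ for all $x\in\mathbb{R}$, and for some $j\in\{1,\dots,N\}$ at least one of $\nu_j$, $m_j$ is strictly monotonic. Then $S_{H_{G_1,\dots,G_m}}=\bigcup_{j=1}^m S_{G_j}$.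
   Context: A cumulative distribution function (cdf) is a non-decreasing right continuous $F:\mathbb{R}\to\mathbb{R}$ with limits $0$ at $-\infty$ and $1$ at $+\infty$. The support of a cdf $F$ is $S_F=\{x\in\mathbb{R}:F(x)-F(x-\varepsilon)>0\ \ \forall\varepsilon>0\}$. A function on $[0,1]^m$ is strictly monotonic if it is strictly monotonic (strictly increasing for $\mu_j,m_j$; strictly decreasing for $\ell_j,\nu_j$) in each of its variables. Conventions: $F(-\infty)=0$, $F(+\infty)=1$, $\int_a^b dF=F(b)-F(a)$ for $a,b\in\mathbb{R}\cup\{\pm\infty\}$; sup, inf and continuity for extended-real-valued functions are in $\mathbb{R}\cup\{\pm\infty\}$. A function $h$ on $[0,1]^m$ is right continuous if $h(s)\to h(t)$ as $s\to t$ with $s_i\ge t_i$ for all $i$. For cdfs $G_1,\dots,G_m$ ($m\ge1$) write $h(.)(x)=h(G_1(x),\dots,G_m(x))$, $\mathbf0=(0,\dots,0)$, $\mathbf1=(1,\dots,1)$. Say $f:\mathbb{R}\to\mathbb{R}\cup\{\pm\infty\}$ is compatible with a cdf $F$ if for every $x_0$ such that $f(x_0)$ is a discontinuity point of $F$, $f$ is continuous at $x_0$ and constant on some $[x_0,x_0+\delta)$, $\delta>0$. **Form A.** Data: $n\ge1$; $F:\mathbb{R}\to\mathbb{R}$; monotonic right continuous $\mathcal U,\vartheta:[0,1]^m\to\mathbb{R}$ and $\mu_j,\ell_j,\nu_j,m_j:[0,1]^m\to\mathbb{R}\cup\{\pm\infty\}$, $1\le j\le n$, with: (1) $F$ a cdf,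 $\mathcal U,\vartheta\ge0$; (2) $\mu_j,m_j,\mathcal U$ non-decreasing, $\ell_j,\nu_j,\vartheta$ non-increasing in all variables; (3) if $\mathcal U(\mathbf0)\ne\vartheta(\mathbf0)$, then [$\mathcal U(\mathbf0)=0$ or $\mu_j(\mathbf0)=\ell_j(\mathbf0)\ \forall j$] and [$\vartheta(\mathbf0)=0$ or $m_j(\mathbf0)=\nu_j(\mathbf0)\ \forall j$]; (4) if $\mathcal U(\mathbf0)=\vartheta(\mathbf0)\ne0$, then $\mu_j(\mathbf0)=\nu_j(\mathbf0)$ and $m_j(\mathbf0)=\ell_j(\mathbf0)\ \forall j$; (5) $\ell_j(\mathbf0)\le\mu_j(\mathbf0)\ \forall j$, and if $\vartheta(\mathbf0)\ne0$ then $m_j(\mathbf1)\le\nu_j(\mathbf1)\ \forall j$; (6) $\mu_n(\mathbf1)\ge\sup\{x:F(x)<1\}$ and $\ell_1(\mathbf1)\le\inf\{x:F(x)>0\}$; (7) $\mathcal U(\mathbf1)=1$; (8) $\vartheta(\mathbf1)=0$ or $\nu_j(\mathbf1)=m_j(\mathbf1)\ \forall j$; (9) $\mu_j(\mathbf1)=\ell_{j+1}(\mathbf1)$ for $1\le j\le n-1$; (10) $F$ is continuous or all functions $x\mapsto\ell_j(.)(x)$, $x\mapsto\nu_j(.)(x)$ are compatible with $F$; moreover $F$ has no discontinuity at any of the values of $\ell_j,\mu_j,m_j,\nu_j$ at $\mathbf0$ and $\mathbf1$. The generated function is $$H_{G_1,\dots,G_m}(x)=\mathcal U(.)(x)\sum_{j=1}^n\int_{\ell_j(.)(x)}^{\mu_j(.)(x)}dF(t)-\vartheta(.)(x)\sum_{j=1}^n\int_{m_j(.)(x)}^{\nu_j(.)(x)}dF(t).$$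 **Form B.** Data: $\eta\ge1$; $\varphi:\mathbb{R}\to\mathbb{R}$; monotonic right continuous $\mathcal U,\vartheta:[0,1]^m\to\mathbb{R}$ and $\mu_j,\ell_j,\nu_j,m_j:[0,1]^m\to\mathbb{R}\cup\{\pm\infty\}$, $1\le j\le\eta$, with: (1) $\varphi$ a cdf, $\mathcal U,\vartheta\ge0$; (2) $\mu_j,m_j,\mathcal U$ non-decreasing, $\ell_j,\nu_j,\vartheta$ non-increasing in all variables; (3) if $\mathcal U(\mathbf1)\ne\vartheta(\mathbf1)$, then [$\vartheta(\mathbf1)=0$ or $m_j(\mathbf1)=\nu_j(\mathbf1)\ \forall j$] and [$\mathcal U(\mathbf1)=0$ or $\ell_j(\mathbf1)=\mu_j(\mathbf1)\ \forall j$]; (4) if $\mathcal U(\mathbf1)=\vartheta(\mathbf1)\ne0$, then $\mu_j(\mathbf1)=\nu_j(\mathbf1)$ and $m_j(\mathbf1)=\ell_j(\mathbf1)\ \forall j$; (5) $m_j(\mathbf1)\le\nu_j(\mathbf1)\ \forall j$, and if $\mathcal U(\mathbf1)\ne0$ then $\ell_j(\mathbf0)\le\mu_j(\mathbf0)\ \forall j$; (6) $\nu_\eta(\mathbf0)\ge\sup\{x:\varphi(x)<1\}$ and $m_1(\mathbf0)\le\inf\{x:\varphi(x)>0\}$; (7) $\vartheta(\mathbf0)=1$; (8) $\mathcal U(\mathbf0)=0$ or $\ell_j(\mathbf0)=\mu_j(\mathbf0)\ \forall j$; (9) $\nu_j(\mathbf0)=m_{j+1}(\mathbf0)$ for $1\le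 j\le\eta-1$; (10) $\varphi$ is continuous or all functions $x\mapsto\ell_j(.)(x)$, $x\mapsto\nu_j(.)(x)$ are compatible with $\varphi$; moreover $\varphi$ has no discontinuity at any of the values of $\ell_j,\mu_j,m_j,\nu_j$ at $\mathbf0$ and $\mathbf1$. The generated function is $$H_{G_1,\dots,G_m}(x)=1-\vartheta(.)(x)\sum_{j=1}^\eta\int_{m_j(.)(x)}^{\nu_j(.)(x)}d\varphi(t)+\mathcal U(.)(x)\sum_{j=1}^\eta\int_{\ell_j(.)(x)}^{\mu_j(.)(x)}d\varphi(t).$$ *)

theory Defs
  imports "HOL-Analysis.Analysis"
begin

definition is_cdf :: "(real \<Rightarrow> real) \<Rightarrow> bool" where
  "is_cdf F \<longleftrightarrow> mono F \<and> (\<forall>x. continuous (at_right x) F) \<and>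
     (F \<longlongrightarrow> 0) at_bot \<and> (F \<longlongrightarrow> 1) at_top"

text \<open>Only increments to the left of \<open>x\<close> count, so this is in general smaller than the
  topological support of the measure induced by \<open>F\<close>.\<close>

definition cdf_support :: "(real \<Rightarrow> real) \<Rightarrow> real set" where
  "cdf_support F = {x. \<forall>\<epsilon>>0. F x - F (x - \<epsilon>) > 0}"

definition cdf_ext :: "(real \<Rightarrow> real) \<Rightarrow> ereal \<Rightarrow> real" where
  "cdf_ext F z = (if z = \<infinity> then 1 else if z = -\<infinity> then 0 else F (real_of_ereal z))"

text \<open>The integral of \<open>dF\<close> from \<open>a\<close> to \<open>b\<close>; it may be negative when \<open>b < a\<close>.\<close>

definition cdf_integral :: "(real \<Rightarrow> real) \<Rightarrow> ereal \<Rightarrow> ereal \<Rightarrow> real" where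
  "cdf_integral F a b = cdf_ext F b - cdf_ext F a"

definition cdf_upper :: "(real \<Rightarrow> real) \<Rightarrow> ereal" where
  "cdf_upper F = (SUP x\<in>{x. F x < 1}. ereal x)"

definition cdf_lower :: "(real \<Rightarrow> real) \<Rightarrow> ereal" where
  "cdf_lower F = (INF x\<in>{x. F x > 0}. ereal x)"

definition discontinuity_point :: "(real \<Rightarrow> real) \<Rightarrow> ereal \<Rightarrow> bool" where
  "discontinuity_point F z \<longleftrightarrow> (\<exists>y. z = ereal y \<and> \<not> isCont F y)"

definition compatible :: "(real \<Rightarrow> real) \<Rightarrow> (real \<Rightarrow> ereal) \<Rightarrow> bool" where
  "compatible F f \<longleftrightarrow> (\<forall>x0. discontinuity_point F (f x0) \<longrightarrow>
     isCont f x0 \<and> (\<exists>\<delta>>0. \<forall>x\<in>{x0..<x0 + \<delta>}. f x = f x0))"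

text \<open>The order on \<^typ>\<open>real ^ 'm\<close> is componentwise and \<open>0\<close>, \<open>1\<close> are the constant vectors,
  so \<open>{0..1}\<close> is the unit cube and, for \<open>t\<close> in the cube, \<open>{t..1}\<close> consists of its points
  \<open>s\<close> with \<open>s $ i \<ge> t $ i\<close> for all \<open>i\<close>. Values outside the cube are irrelevant.\<close>

definition right_cont_cube :: "(real ^ 'm \<Rightarrow> 'b::topological_space) \<Rightarrow> bool" where
  "right_cont_cube h \<longleftrightarrow> (\<forall>t\<in>{0..1}. (h \<longlongrightarrow> h t) (at t within {t..1}))"

text \<open>Monotonicity in each variable separately; the relation \<open>R\<close> is one of
  \<open>(\<le>)\<close>, \<open>(\<ge>)\<close>, \<open>(<)\<close>, \<open>(>)\<close>.\<close>

definition monotone_each :: "('b \<Rightarrow> 'b \<Rightarrow> bool) \<Rightarrow> (real ^ 'm \<Rightarrow> 'b) \<Rightarrow> bool" where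
  "monotone_each R h \<longleftrightarrow> (\<forall>i. \<forall>s\<in>{0..1}. \<forall>t\<in>{0..1}.
     s $ i < t $ i \<and> (\<forall>k. k \<noteq> i \<longrightarrow> s $ k = t $ k) \<longrightarrow> R (h s) (h t))"

definition cdf_vec :: "('m \<Rightarrow> real \<Rightarrow> real) \<Rightarrow> real \<Rightarrow> real ^ 'm" where
  "cdf_vec G x = (\<chi> i. G i x)"

text \<open>The assumptions shared by the two ways of generating a cdf. The family \<open>G\<close> is a
  parameter because compatibility depends on it.\<close>

locale generator =
  fixes N :: nat
    and \<Phi> :: "real \<Rightarrow> real"
    and U \<theta> :: "real ^ 'm \<Rightarrow> real"
    and \<mu> l \<nu> m :: "nat \<Rightarrow> real ^ 'm \<Rightarrow> ereal"
    and G :: "'m \<Rightarrow> real \<Rightarrow> real"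
  assumes N_pos: "N \<ge> 1"
    and cdf_\<Phi>: "is_cdf \<Phi>"
    and nonneg: "\<forall>s\<in>{0..1}. U s \<ge> 0 \<and> \<theta> s \<ge> 0"
    and right_cont_coeff: "right_cont_cube U" "right_cont_cube \<theta>"
    and right_cont_bounds:
      "\<forall>j\<in>{1..N}. right_cont_cube (\<mu> j) \<and> right_cont_cube (l j) \<and>
                  right_cont_cube (\<nu> j) \<and> right_cont_cube (m j)"
    and mono_coeff: "monotone_each (\<le>) U" "monotone_each (\<ge>) \<theta>"
    and mono_bounds:
      "\<forall>j\<in>{1..N}. monotone_each (\<le>) (\<mu> j) \<and> monotone_each (\<le>) (m j) \<and>
                  monotone_each (\<ge>) (l j) \<and> monotone_each (\<ge>) (\<nu> j)"
    and cont_or_compatible: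
      "(\<forall>x. isCont \<Phi> x) \<or>
       (\<forall>j\<in>{1..N}. compatible \<Phi> (\<lambda>x. l j (cdf_vec G x)) \<and>
                   compatible \<Phi> (\<lambda>x. \<nu> j (cdf_vec G x)))"
    and no_discontinuity:
      "\<forall>j\<in>{1..N}. \<forall>f\<in>{l j, \<mu> j, m j, \<nu> j}. \<forall>p\<in>{0, 1}. \<not> discontinuity_point \<Phi> (f p)"

locale form_A = generator +
  assumes A_neq: "U 0 \<noteq> \<theta> 0 \<Longrightarrow>
      (U 0 = 0 \<or> (\<forall>j\<in>{1..N}. \<mu> j 0 = l j 0)) \<and>
      (\<theta> 0 = 0 \<or> (\<forall>j\<in>{1..N}. m j 0 = \<nu> j 0))"
    and A_eq: "U 0 = \<theta> 0 \<Longrightarrow> U 0 \<noteq> 0 \<Longrightarrow>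
      \<forall>j\<in>{1..N}. \<mu> j 0 = \<nu> j 0 \<and> m j 0 = l j 0"
    and A_l_le_\<mu>: "\<forall>j\<in>{1..N}. l j 0 \<le> \<mu> j 0"
    and A_m_le_\<nu>: "\<theta> 0 \<noteq> 0 \<Longrightarrow> \<forall>j\<in>{1..N}. m j 1 \<le> \<nu> j 1"
    and A_ends: "\<mu> N 1 \<ge> cdf_upper \<Phi>" "l 1 1 \<le> cdf_lower \<Phi>"
    and A_U1: "U 1 = 1"
    and A_\<theta>1: "\<theta> 1 = 0 \<or> (\<forall>j\<in>{1..N}. \<nu> j 1 = m j 1)"
    and A_chain: "\<forall>j. 1 \<le> j \<and> j \<le> N - 1 \<longrightarrow> \<mu> j 1 = l (j + 1) 1"

definition generated_A ::
  "nat \<Rightarrow> (real \<Rightarrow> real) \<Rightarrow> (real ^ 'm \<Rightarrow> real) \<Rightarrow> (real ^ 'm \<Rightarrow> real) \<Rightarrow>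
   (nat \<Rightarrow> real ^ 'm \<Rightarrow> ereal) \<Rightarrow> (nat \<Rightarrow> real ^ 'm \<Rightarrow> ereal) \<Rightarrow>
   (nat \<Rightarrow> real ^ 'm \<Rightarrow> ereal) \<Rightarrow> (nat \<Rightarrow> real ^ 'm \<Rightarrow> ereal) \<Rightarrow>
   ('m \<Rightarrow> real \<Rightarrow> real) \<Rightarrow> real \<Rightarrow> real" where
  "generated_A n F U \<theta> \<mu> l \<nu> m G x =
     (let s = cdf_vec G x in
        U s * (\<Sum>j=1..n. cdf_integral F (l j s) (\<mu> j s))
        - \<theta> s * (\<Sum>j=1..n. cdf_integral F (m j s) (\<nu> j s)))"

locale form_B = generator +
  assumes B_neq: "U 1 \<noteq> \<theta> 1 \<Longrightarrow>
      (\<theta> 1 = 0 \<or> (\<forall>j\<in>{1..N}. m j 1 = \<nu> j 1)) \<and>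
      (U 1 = 0 \<or> (\<forall>j\<in>{1..N}. l j 1 = \<mu> j 1))"
    and B_eq: "U 1 = \<theta> 1 \<Longrightarrow> U 1 \<noteq> 0 \<Longrightarrow>
      \<forall>j\<in>{1..N}. \<mu> j 1 = \<nu> j 1 \<and> m j 1 = l j 1"
    and B_m_le_\<nu>: "\<forall>j\<in>{1..N}. m j 1 \<le> \<nu> j 1"
    and B_l_le_\<mu>: "U 1 \<noteq> 0 \<Longrightarrow> \<forall>j\<in>{1..N}. l j 0 \<le> \<mu> j 0"
    and B_ends: "\<nu> N 0 \<ge> cdf_upper \<Phi>" "m 1 0 \<le> cdf_lower \<Phi>"
    and B_\<theta>0: "\<theta> 0 = 1"
    and B_U0: "U 0 = 0 \<or> (\<forall>j\<in>{1..N}. l j 0 = \<mu> j 0)"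
    and B_chain: "\<forall>j. 1 \<le> j \<and> j \<le> N - 1 \<longrightarrow> \<nu> j 0 = m (j + 1) 0"

definition generated_B ::
  "nat \<Rightarrow> (real \<Rightarrow> real) \<Rightarrow> (real ^ 'm \<Rightarrow> real) \<Rightarrow> (real ^ 'm \<Rightarrow> real) \<Rightarrow>
   (nat \<Rightarrow> real ^ 'm \<Rightarrow> ereal) \<Rightarrow> (nat \<Rightarrow> real ^ 'm \<Rightarrow> ereal) \<Rightarrow>
   (nat \<Rightarrow> real ^ 'm \<Rightarrow> ereal) \<Rightarrow> (nat \<Rightarrow> real ^ 'm \<Rightarrow> ereal) \<Rightarrow>
   ('m \<Rightarrow> real \<Rightarrow> real) \<Rightarrow> real \<Rightarrow> real" where
  "generated_B n \<phi> U \<theta> \<mu> l \<nu> m G x =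
     (let s = cdf_vec G x in
        1 - \<theta> s * (\<Sum>j=1..n. cdf_integral \<phi> (m j s) (\<nu> j s))
        + U s * (\<Sum>j=1..n. cdf_integral \<phi> (l j s) (\<mu> j s)))"

end

theory Submission
  imports Defs
begin

text \<open>The generated function is \<open>x \<mapsto> c + U(s)A(s) - \<theta>(s)B(s)\<close> at \<open>s = (G\<^sub>1(x), \<dots>, G\<^sub>m(x))\<close>, where \<open>A\<close>
  and \<open>B\<close> are the sums of integrals and \<open>c\<close> is \<open>0\<close> or \<open>1\<close>. As a function of \<open>s\<close>, the first
  product is non-decreasing and the second non-increasing. If no \<open>G\<^sub>i\<close> increases just to the
  left of \<open>x\<close>, then \<open>s\<close>, and hence \<open>H\<close>, is constant there. Conversely, a strict increase of
  some \<open>G\<^sub>i\<close> strictly moves the strictly monotonic integration bound. By the chain conditions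
  this bound stays in \<open>[inf {\<Phi> > 0}, sup {\<Phi> < 1}]\<close>, and \<open>\<Phi>\<close> is strictly increasing
  on that interval because its support has no gaps. In case (b) of Form A, and dually in case
  (a) of Form B, the chain for the other pair of bounds comes from condition (4), since under
  condition (3) those bounds would all be constant.\<close>

section \<open>Cumulative distribution functions and their supports\<close>

lemma is_cdfD:
  assumes "is_cdf F"
  shows "mono F" "(F \<longlongrightarrow> F x) (at_right x)" "(F \<longlongrightarrow> 0) at_bot" "(F \<longlongrightarrow> 1) at_top"
  using assms by (auto simp: is_cdf_def continuous_within)

lemma cdf_bounds:
  assumes "is_cdf F"
  shows "0 \<le> F x" "F x \<le> 1"
proof -
  have "eventually (\<lambda>y. F y \<le> F x) at_bot"
    using monoD[OF is_cdfD(1)[OF assms]] by (auto simp: eventually_at_bot_linorder)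
  then show "0 \<le> F x"
    by (intro tendsto_upperbound[OF is_cdfD(3)[OF assms]]) auto
  have "eventually (\<lambda>y. F x \<le> F y) at_top"
    using monoD[OF is_cdfD(1)[OF assms]] by (auto simp: eventually_at_top_linorder)
  then show "F x \<le> 1"
    by (intro tendsto_lowerbound[OF is_cdfD(4)[OF assms]]) auto
qed

lemma cdf_ext_mono:
  assumes "is_cdf F" "a \<le> b"
  shows "cdf_ext F a \<le> cdf_ext F b"
  using assms cdf_bounds[OF assms(1)] monoD[OF is_cdfD(1)[OF assms(1)]]
  by (cases a; cases b) (auto simp: cdf_ext_def)

text \<open>The witness is the infimum of the points where \<open>F\<close> has reached
  \<open>q\<close>. The set is bounded below because \<open>F\<close> tends to \<open>0 < q\<close>
  at minus infinity, right continuity keeps \<open>F\<close> at or above \<open>q\<close> at the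
  infimum, and further left \<open>F\<close> is below \<open>q\<close>.\<close>

lemma cdf_support_point_at_level:
  assumes F: "is_cdf F" and "0 < q" "q \<le> F w"
  obtains y where "y \<in> cdf_support F" "q \<le> F y" "y \<le> w"
proof -
  note mono = monoD[OF is_cdfD(1)[OF F]]
  define S where "S = {z. q \<le> F z}"
  define y where "y = Inf S"
  have "w \<in> S" using assms by (simp add: S_def)
  have "eventually (\<lambda>z. F z < q) at_bot"
    using order_tendstoD(2)[OF is_cdfD(3)[OF F] \<open>0 < q\<close>] .
  then obtain z0 where z0: "\<And>z. z \<le> z0 \<Longrightarrow> F z < q"
    by (auto simp: eventually_at_bot_linorder)
  have bdd: "bdd_below S"
    using z0 by (intro bdd_belowI[of _ z0]) (auto simp: S_def not_less[symmetric])
  have above: "q \<le> F z" if less: "y < z" for z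
  proof -
    obtain v where "v \<in> S" "v < z"
      using less cInf_less_iff[OF _ bdd, of z] \<open>w \<in> S\<close> unfolding y_def by blast
    then show ?thesis using mono[of v z] by (simp add: S_def)
  qed
  have Fy: "q \<le> F y"
    by (rule tendsto_lowerbound[OF is_cdfD(2)[OF F, of y]])
       (auto simp: eventually_at_filter above)
  have "F (y - e) < q" if "e > 0" for e
    using cInf_lower[OF _ bdd, of "y - e"] that by (force simp: S_def y_def)
  then have "y \<in> cdf_support F"
    using Fy by (force simp: cdf_support_def)
  moreover have "y \<le> w" using \<open>w \<in> S\<close> bdd by (auto simp: y_def intro: cInf_lower)
  ultimately show thesis using that Fy by blast
qed

text \<open>A common value at \<open>a\<close> and \<open>b\<close> would lie strictly between 0 and
  1. The support then has points at or left of \<open>a\<close> and at or right of \<open>b\<close>,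
  so by convexity it contains \<open>b\<close>, although \<open>F\<close> is flat just to the left
  of \<open>b\<close>.\<close>

lemma cdf_ext_strict_mono:
  assumes F: "is_cdf F" and conv: "convex (cdf_support F)"
    and "cdf_lower F \<le> a" "a < b" "b \<le> cdf_upper F"
  shows "cdf_ext F a < cdf_ext F b"
proof -
  note mono = monoD[OF is_cdfD(1)[OF F]]
  have "cdf_lower F < b" using assms by simp
  then obtain u where "F u > 0" "ereal u < b"
    by (auto simp: cdf_lower_def INF_less_iff)
  then have pos: "cdf_ext F b > 0"
    using cdf_ext_mono[OF F, of "ereal u" b] by (simp add: less_imp_le cdf_ext_def[of F "ereal u"])
  have "a < cdf_upper F" using assms by simp
  then obtain v where "F v < 1" "a < ereal v"
    by (auto simp: cdf_upper_def less_SUP_iff)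
  then have less1: "cdf_ext F a < 1"
    using cdf_ext_mono[OF F, of a "ereal v"] by (simp add: less_imp_le cdf_ext_def[of F "ereal v"])
  show ?thesis
  proof (rule ccontr)
    assume "\<not> ?thesis"
    then have eq: "cdf_ext F a = cdf_ext F b"
      using cdf_ext_mono[OF F, of a b] assms by simp
    \<comment> \<open>An infinite bound would force the common value to be 0 or 1.\<close>
    obtain x y where xy: "a = ereal x" "b = ereal y" "x < y"
      using pos less1 eq \<open>a < b\<close> by (cases a; cases b) (auto simp: cdf_ext_def)
    have Fxy: "F x = F y" "0 < F x" "F x < 1"
      using pos less1 eq by (auto simp: xy cdf_ext_def)
    obtain p where p: "p \<in> cdf_support F" "p \<le> x"
      using cdf_support_point_at_level[OF F \<open>0 < F x\<close> order.refl] by blast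
    \<comment> \<open>The level is taken strictly above \<open>F x = F y\<close> so that a support
      point reaching it cannot lie left of \<open>y\<close>.\<close>
    obtain q where q: "F x < q" "q < 1" using dense[OF Fxy(3)] by blast
    obtain w where w: "q < F w"
      using eventually_happens[OF order_tendstoD(1)[OF is_cdfD(4)[OF F] q(2)]] by auto
    obtain r where r: "r \<in> cdf_support F" "q \<le> F r"
      using cdf_support_point_at_level[OF F less_trans[OF Fxy(2) q(1)] less_imp_le[OF w]] by blast
    have "y \<le> r" using mono[of r y] r q Fxy by linarith
    then have "y \<in> closed_segment p r"
      using p xy by (auto simp: closed_segment_eq_real_ivl)
    then have "y \<in> cdf_support F"
      using conv p r by (auto simp: convex_contains_segment)
    then have "\<forall>e>0. F (y - e) < F y" by (simp add: cdf_support_def)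
    from spec[OF this, of "y - x"] show False using \<open>x < y\<close> Fxy by simp
  qed
qed

section \<open>Monotonicity on the unit cube\<close>

text \<open>One walks from \<open>s\<close> to \<open>t\<close> changing one coordinate at a time.
  Since \<open>R\<close> may be strict, hence irreflexive, the induction carries the alternative
  that nothing has moved yet; \<open>s < t\<close> rules it out at the end.\<close>

lemma monotone_each_less:
  fixes h :: "real ^ 'm::finite \<Rightarrow> 'b"
  assumes mono: "monotone_each R h" and R: "transp R"
    and st: "s \<in> {0..1}" "t \<in> {0..1}" "s < t"
  shows "R (h s) (h t)"
proof -
  have le: "s $ i \<le> t $ i" for i
    using st by (auto simp: less_vec_def less_eq_vec_def)
  \<comment> \<open>\<open>w S\<close> has already moved the coordinates in \<open>S\<close> to
    their values in \<open>t\<close>.\<close>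
  define w where "w = (\<lambda>S. \<chi> i. if i \<in> S then t $ i else s $ i)"
  have cube: "w S \<in> {0..1}" for S
    using st by (auto simp: w_def less_eq_vec_def)
  have "w S = s \<or> R (h s) (h (w S))" if "finite S" for S
    using that
  proof induction
    case empty
    then show ?case by (simp add: w_def vec_eq_iff)
  next
    case (insert i S)
    show ?case
    proof (cases "s $ i = t $ i")
      case True
      then have "w (insert i S) = w S" by (auto simp: w_def vec_eq_iff)
      then show ?thesis using insert by simp
    next
      case False
      then have "w S $ i < w (insert i S) $ i" "\<forall>k. k \<noteq> i \<longrightarrow> w S $ k = w (insert i S) $ k"
        using le[of i] insert(2) by (auto simp: w_def)
      then have "R (h (w S)) (h (w (insert i S)))"
        using mono cube unfolding monotone_each_def by blast
      then show ?thesis using insert R by (auto dest: transpD)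
    qed
  qed
  from this[of UNIV] have "w UNIV = s \<or> R (h s) (h (w UNIV))" by simp
  moreover have "w UNIV = t" by (simp add: w_def vec_eq_iff)
  ultimately show ?thesis using st by auto
qed

lemma monotone_each_le:
  fixes h :: "real ^ 'm::finite \<Rightarrow> 'b::preorder"
  assumes "s \<in> {0..1}" "t \<in> {0..1}" "s \<le> t"
  shows "monotone_each (\<le>) h \<Longrightarrow> h s \<le> h t" "monotone_each (\<ge>) h \<Longrightarrow> h t \<le> h s"
proof -
  have "s = t \<or> s < t" using assms by auto
  then show "monotone_each (\<le>) h \<Longrightarrow> h s \<le> h t" "monotone_each (\<ge>) h \<Longrightarrow> h t \<le> h s"
    using monotone_each_less[of "(\<le>)" h s t] monotone_each_less[of "(\<ge>)" h s t] assms
    by auto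
qed

lemma cdf_vec_cube:
  fixes G :: "'m::finite \<Rightarrow> real \<Rightarrow> real"
  assumes "\<forall>i. is_cdf (G i)"
  shows "cdf_vec G x \<in> {0..1}"
  using assms cdf_bounds by (auto simp: cdf_vec_def less_eq_vec_def)

section \<open>Weighted sums of integrals over nested intervals\<close>

lemma cdf_integral_mono:
  assumes "is_cdf F" "a \<le> a'" "b' \<le> b"
  shows "cdf_integral F a' b' \<le> cdf_integral F a b"
  using cdf_ext_mono[OF assms(1,2)] cdf_ext_mono[OF assms(1,3)] by (simp add: cdf_integral_def)

lemma cdf_integral_strict_mono:
  assumes "is_cdf F" "convex (cdf_support F)" "cdf_lower F \<le> a" "b \<le> cdf_upper F"
    and "a \<le> a'" "a' \<le> b'" "b' \<le> b" "a < a' \<or> b' < b"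
  shows "cdf_integral F a' b' < cdf_integral F a b"
  using assms(8)
proof
  assume "a < a'"
  then have "cdf_ext F a < cdf_ext F a'"
    using assms by (intro cdf_ext_strict_mono) auto
  then show ?thesis
    using cdf_ext_mono[OF assms(1,7)] by (simp add: cdf_integral_def)
next
  assume "b' < b"
  then have "cdf_ext F b' < cdf_ext F b"
    using assms by (intro cdf_ext_strict_mono) auto
  then show ?thesis
    using cdf_ext_mono[OF assms(1,5)] by (simp add: cdf_integral_def)
qed

text \<open>Primes mark the inner intervals. When these are correctly oriented, all factors are
  nonnegative and the products compare; orientation may fail only where \<open>u = 0\<close>, and
  then both sides vanish.\<close>

lemma weighted_integral_mono:
  assumes F: "is_cdf F" and u: "0 \<le> u'" "u' \<le> u"
    and inner: "u = 0 \<or> (\<forall>j\<in>{1..N::nat}. a' j \<le> b' j)"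
    and outer: "\<forall>j\<in>{1..N}. a j \<le> a' j \<and> b' j \<le> b j"
  shows "u' * (\<Sum>j=1..N. cdf_integral F (a' j) (b' j)) \<le> u * (\<Sum>j=1..N. cdf_integral F (a j) (b j))"
proof (cases "u = 0")
  case False
  have "0 \<le> (\<Sum>j=1..N. cdf_integral F (a' j) (b' j))"
    using inner False cdf_ext_mono[OF F] by (intro sum_nonneg) (auto simp: cdf_integral_def)
  moreover have "(\<Sum>j=1..N. cdf_integral F (a' j) (b' j)) \<le> (\<Sum>j=1..N. cdf_integral F (a j) (b j))"
    using outer by (intro sum_mono cdf_integral_mono[OF F]) auto
  ultimately show ?thesis using u by (intro mult_mono) auto
qed (use u in simp)

text \<open>One strictly widened interval makes the sum larger, and \<open>u' > 0\<close> preserves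
  the gain. Only this interval has to stay where \<open>F\<close> is known to be strictly
  increasing.\<close>

lemma weighted_integral_strict_mono:
  assumes F: "is_cdf F" and conv: "convex (cdf_support F)" and u: "0 < u'" "u' \<le> u"
    and inner: "\<forall>j\<in>{1..N::nat}. a' j \<le> b' j"
    and outer: "\<forall>j\<in>{1..N}. a j \<le> a' j \<and> b' j \<le> b j"
    and k: "k \<in> {1..N}" "a k < a' k \<or> b' k < b k"
    and ends: "cdf_lower F \<le> a k" "b k \<le> cdf_upper F"
  shows "u' * (\<Sum>j=1..N. cdf_integral F (a' j) (b' j)) < u * (\<Sum>j=1..N. cdf_integral F (a j) (b j))"
proof -
  have "0 \<le> (\<Sum>j=1..N. cdf_integral F (a' j) (b' j))"
    using inner cdf_ext_mono[OF F] by (intro sum_nonneg) (auto simp: cdf_integral_def)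
  moreover have "(\<Sum>j=1..N. cdf_integral F (a' j) (b' j)) < (\<Sum>j=1..N. cdf_integral F (a j) (b j))"
  proof (rule sum_strict_mono_ex1)
    show "\<forall>j\<in>{1..N}. cdf_integral F (a' j) (b' j) \<le> cdf_integral F (a j) (b j)"
      using outer by (auto intro: cdf_integral_mono[OF F])
    show "\<exists>j\<in>{1..N}. cdf_integral F (a' j) (b' j) < cdf_integral F (a j) (b j)"
      using k inner outer ends by (intro bexI[of _ k] cdf_integral_strict_mono[OF F conv]) auto
  qed simp
  ultimately show ?thesis using u by (auto intro!: mult_le_less_imp_less)
qed

text \<open>Both bounds are read off the chain
  \<open>a 1 \<le> b 1 \<le> a 2 \<le> b 2 \<le> ...\<close>.\<close>

lemma chain_bounds:
  fixes a b :: "nat \<Rightarrow> 'a::preorder"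
  assumes ab: "\<forall>j\<in>{1..N}. a j \<le> b j"
    and ba: "\<forall>j. 1 \<le> j \<and> j \<le> N - 1 \<longrightarrow> b j \<le> a (j + 1)"
    and k: "k \<in> {1..N}"
  shows "a 1 \<le> a k" "b k \<le> b N"
proof -
  have "1 \<le> k" "k \<le> N" using k by auto
  from this(1,2) show "a 1 \<le> a k"
  proof (induction k rule: dec_induct)
    case (step n)
    then have "a 1 \<le> a n" "a n \<le> b n" "b n \<le> a (Suc n)" using ab ba[rule_format, of n] by auto
    then show ?case by (blast intro: order_trans)
  qed simp
  from \<open>k \<le> N\<close> \<open>1 \<le> k\<close> show "b k \<le> b N"
  proof (induction k rule: inc_induct)
    case (step n)
    then have "b (Suc n) \<le> b N" "a (Suc n) \<le> b (Suc n)" "b n \<le> a (Suc n)"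
      using ab ba[rule_format, of n] by auto
    then show ?case by (blast intro: order_trans)
  qed simp
qed

section \<open>Generators and the monotonicity of their two parts\<close>

lemma (in generator) bounds_mono:
  assumes "s \<in> {0..1}" "t \<in> {0..1}" "s \<le> t" "j \<in> {1..N}"
  shows "\<mu> j s \<le> \<mu> j t" "m j s \<le> m j t" "l j t \<le> l j s" "\<nu> j t \<le> \<nu> j s"
  using mono_bounds assms monotone_each_le[OF assms(1-3)] by blast+

lemma (in generator) coeff_mono:
  assumes "s \<in> {0..1}" "t \<in> {0..1}" "s \<le> t"
  shows "0 \<le> U s" "U s \<le> U t" "0 \<le> \<theta> t" "\<theta> t \<le> \<theta> s"
  using mono_coeff nonneg assms monotone_each_le[OF assms] by blast+

text \<open>The chains at \<open>1\<close> and at \<open>0\<close> are only guaranteed in the presence of a strictly monotonic bound of the respective pair.\<close>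

locale monotone_generator = generator +
  assumes U_cases: "U 1 = 0 \<or> (\<forall>j\<in>{1..N}. l j 0 \<le> \<mu> j 0)"
    and \<theta>_cases: "\<theta> 0 = 0 \<or> (\<forall>j\<in>{1..N}. m j 1 \<le> \<nu> j 1)"
    and U_chain: "U 1 \<noteq> 0 \<Longrightarrow> \<exists>j\<in>{1..N}. \<mu> j 0 < \<mu> j 1 \<or> l j 1 < l j 0 \<Longrightarrow>
      \<forall>j. 1 \<le> j \<and> j \<le> N - 1 \<longrightarrow> \<mu> j 1 \<le> l (j + 1) 1"
    and \<theta>_chain: "\<theta> 0 \<noteq> 0 \<Longrightarrow> \<exists>j\<in>{1..N}. \<nu> j 1 < \<nu> j 0 \<or> m j 0 < m j 1 \<Longrightarrow>
      \<forall>j. 1 \<le> j \<and> j \<le> N - 1 \<longrightarrow> \<nu> j 0 \<le> m (j + 1) 0"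

lemma form_A_monotone_generator:
  assumes "form_A N \<Phi> U \<theta> \<mu> l \<nu> m G"
  shows "monotone_generator N \<Phi> U \<theta> \<mu> l \<nu> m G"
proof -
  interpret form_A N \<Phi> U \<theta> \<mu> l \<nu> m G by fact
  have corners: "(0::real^'a) \<in> {0..1}" "(1::real^'a) \<in> {0..1}" "(0::real^'a) \<le> 1"
    by (auto simp: less_eq_vec_def)
  note bounds = bounds_mono[OF corners]
  show ?thesis
  proof unfold_locales
    assume \<theta>: "\<theta> 0 \<noteq> 0" and ex: "\<exists>j\<in>{1..N}. \<nu> j 1 < \<nu> j 0 \<or> m j 0 < m j 1"
    then obtain k where k: "k \<in> {1..N}" "\<nu> k 1 < \<nu> k 0 \<or> m k 0 < m k 1" by blast
    \<comment> \<open>Equality would collapse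
      \<open>m k 0 \<le> m k 1 \<le> \<nu> k 1 \<le> \<nu> k 0\<close>, so neither bound could
      move.\<close>
    have "m k 0 \<noteq> \<nu> k 0"
      using bounds(2,4)[OF k(1)] bspec[OF A_m_le_\<nu>[OF \<theta>] k(1)] k(2) by auto
    then have "U 0 = \<theta> 0" using A_neq \<theta> k by blast
    then have eq: "\<mu> j 0 = \<nu> j 0" "m j 0 = l j 0" if "j \<in> {1..N}" for j
      using A_eq \<theta> that by auto
    show "\<forall>j. 1 \<le> j \<and> j \<le> N - 1 \<longrightarrow> \<nu> j 0 \<le> m (j + 1) 0"
    proof (intro allI impI)
      fix j assume j: "1 \<le> j \<and> j \<le> N - 1"
      then have mem: "j \<in> {1..N}" "j + 1 \<in> {1..N}" by auto
      \<comment> \<open>The chain at 0 is obtained by passing to the other pair of bounds, using its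
        chain at 1, and returning.\<close>
      have "\<nu> j 0 = \<mu> j 0" using eq mem by simp
      also have "\<dots> \<le> \<mu> j 1" using bounds mem by blast
      also have "\<dots> = l (j + 1) 1" using A_chain j by blast
      also have "\<dots> \<le> l (j + 1) 0" using bounds mem by blast
      also have "\<dots> = m (j + 1) 0" using eq mem by simp
      finally show "\<nu> j 0 \<le> m (j + 1) 0" .
    qed
  next
    show "\<forall>j. 1 \<le> j \<and> j \<le> N - 1 \<longrightarrow> \<mu> j 1 \<le> l (j + 1) 1"
      using A_chain by (intro allI impI eq_refl) blast
  qed (use A_l_le_\<mu> A_m_le_\<nu> in blast)+
qed

lemma form_B_monotone_generator:
  assumes "form_B N \<Phi> U \<theta> \<mu> l \<nu> m G"
  shows "monotone_generator N \<Phi> U \<theta> \<mu> l \<nu> m G"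
proof -
  interpret form_B N \<Phi> U \<theta> \<mu> l \<nu> m G by fact
  have corners: "(0::real^'a) \<in> {0..1}" "(1::real^'a) \<in> {0..1}" "(0::real^'a) \<le> 1"
    by (auto simp: less_eq_vec_def)
  note bounds = bounds_mono[OF corners]
  show ?thesis
  proof unfold_locales
    assume U: "U 1 \<noteq> 0" and ex: "\<exists>j\<in>{1..N}. \<mu> j 0 < \<mu> j 1 \<or> l j 1 < l j 0"
    then obtain k where k: "k \<in> {1..N}" "\<mu> k 0 < \<mu> k 1 \<or> l k 1 < l k 0" by blast
    \<comment> \<open>Dually, equality would collapse
      \<open>l k 1 \<le> l k 0 \<le> \<mu> k 0 \<le> \<mu> k 1\<close>.\<close>
    have "l k 1 \<noteq> \<mu> k 1"
      using bounds(1,3)[OF k(1)] bspec[OF B_l_le_\<mu>[OF U] k(1)] k(2) by auto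
    then have "U 1 = \<theta> 1" using B_neq U k by blast
    then have eq: "\<mu> j 1 = \<nu> j 1" "m j 1 = l j 1" if "j \<in> {1..N}" for j
      using B_eq U that by auto
    show "\<forall>j. 1 \<le> j \<and> j \<le> N - 1 \<longrightarrow> \<mu> j 1 \<le> l (j + 1) 1"
    proof (intro allI impI)
      fix j assume j: "1 \<le> j \<and> j \<le> N - 1"
      then have mem: "j \<in> {1..N}" "j + 1 \<in> {1..N}" by auto
      have "\<mu> j 1 = \<nu> j 1" using eq mem by simp
      also have "\<dots> \<le> \<nu> j 0" using bounds mem by blast
      also have "\<dots> = m (j + 1) 0" using B_chain j by blast
      also have "\<dots> \<le> m (j + 1) 1" using bounds mem by blast
      also have "\<dots> = l (j + 1) 1" using eq mem by simp
      finally show "\<mu> j 1 \<le> l (j + 1) 1" .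
    qed
  next
    show "\<forall>j. 1 \<le> j \<and> j \<le> N - 1 \<longrightarrow> \<nu> j 0 \<le> m (j + 1) 0"
      using B_chain by (intro allI impI eq_refl) blast
  qed (use B_l_le_\<mu> B_m_le_\<nu> in blast)+
qed

context monotone_generator
begin

abbreviation U_part :: "real ^ 'a \<Rightarrow> real" where
  "U_part s \<equiv> U s * (\<Sum>j=1..N. cdf_integral \<Phi> (l j s) (\<mu> j s))"

abbreviation \<theta>_part :: "real ^ 'a \<Rightarrow> real" where
  "\<theta>_part s \<equiv> \<theta> s * (\<Sum>j=1..N. cdf_integral \<Phi> (m j s) (\<nu> j s))"

lemma cube_corners:
  "(0::real^'a) \<in> {0..1}" "(1::real^'a) \<in> {0..1}" "(0::real^'a) < 1"
  "s \<in> {0..1} \<Longrightarrow> 0 \<le> s" "s \<in> {0..1} \<Longrightarrow> s \<le> (1::real^'a)"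
  by (auto simp: less_vec_def less_eq_vec_def)

text \<open>These intervals grow with \<open>s\<close>, so the orientation at 0 propagates to the
  whole cube.\<close>

lemma l_le_\<mu>:
  assumes "s \<in> {0..1}" "U 1 \<noteq> 0" "j \<in> {1..N}"
  shows "l j s \<le> \<mu> j s"
  using U_cases bounds_mono(1,3)[OF cube_corners(1) assms(1) cube_corners(4)[OF assms(1)] assms(3)] assms
  by (meson order_trans)

text \<open>These intervals shrink as \<open>s\<close> grows, so here the orientation at 1 is
  decisive.\<close>

lemma m_le_\<nu>:
  assumes "s \<in> {0..1}" "\<theta> 0 \<noteq> 0" "j \<in> {1..N}"
  shows "m j s \<le> \<nu> j s"
  using \<theta>_cases bounds_mono(2,4)[OF assms(1) cube_corners(2) cube_corners(5)[OF assms(1)] assms(3)] assms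
  by (meson order_trans)

lemma parts_mono:
  assumes st: "s \<in> {0..1}" "t \<in> {0..1}" "s \<le> t"
  shows "U_part s \<le> U_part t" "\<theta>_part t \<le> \<theta>_part s"
proof -
  \<comment> \<open>If \<open>U 1 = 0\<close>, monotonicity makes \<open>U\<close> vanish on the
    whole cube; otherwise the intervals are correctly oriented.\<close>
  have U: "U t = 0 \<or> (\<forall>j\<in>{1..N}. l j s \<le> \<mu> j s)"
  proof (cases "U 1 = 0")
    case True
    then show ?thesis
      using coeff_mono(1,2)[OF st(2) cube_corners(2) cube_corners(5)[OF st(2)]] by simp
  qed (use l_le_\<mu>[OF st(1)] in simp)
  show "U_part s \<le> U_part t"
    by (rule weighted_integral_mono[OF cdf_\<Phi>])
       (use U coeff_mono[OF st] bounds_mono[OF st] in blast)+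
  have \<theta>: "\<theta> s = 0 \<or> (\<forall>j\<in>{1..N}. m j t \<le> \<nu> j t)"
  proof (cases "\<theta> 0 = 0")
    case True
    then show ?thesis
      using coeff_mono(3,4)[OF cube_corners(1) st(1) cube_corners(4)[OF st(1)]] by simp
  qed (use m_le_\<nu>[OF st(2)] in simp)
  show "\<theta>_part t \<le> \<theta>_part s"
    by (rule weighted_integral_mono[OF cdf_\<Phi>])
       (use \<theta> coeff_mono[OF st] bounds_mono[OF st] in blast)+
qed

text \<open>The interval of index \<open>k\<close> is widest at 1, where the chain confines it
  between \<open>l 1 1\<close> and \<open>\<mu> N 1\<close>, the ends of the range on which
  \<open>\<Phi>\<close> increases strictly.\<close>

lemma U_part_strict_mono:
  assumes conv: "convex (cdf_support \<Phi>)"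
    and ends: "\<mu> N 1 = cdf_upper \<Phi>" "l 1 1 = cdf_lower \<Phi>"
    and k: "k \<in> {1..N}" "monotone_each (<) (\<mu> k) \<or> monotone_each (>) (l k)"
    and st: "s \<in> {0..1}" "t \<in> {0..1}" "s < t" "U s > 0"
  shows "U_part s < U_part t"
proof -
  have strict: "l k q < l k p \<or> \<mu> k p < \<mu> k q" if "p \<in> {0..1}" "q \<in> {0..1}" "p < q" for p q
    using k(2) monotone_each_less[of "(<)" "\<mu> k" p q] monotone_each_less[of "(>)" "l k" p q] that
    by auto
  have U1: "U 1 \<noteq> 0" using coeff_mono(2)[OF st(1) cube_corners(2) cube_corners(5)[OF st(1)]] st(4) by simp
  \<comment> \<open>Strictness between the corners 0 and 1 supplies the moving bound that
    \<open>U_chain\<close> asks for.\<close>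
  have "\<forall>j. 1 \<le> j \<and> j \<le> N - 1 \<longrightarrow> \<mu> j 1 \<le> l (j + 1) 1"
    using U_chain[OF U1] strict[OF cube_corners(1-3)] k(1) by blast
  moreover have "\<forall>j\<in>{1..N}. l j 1 \<le> \<mu> j 1" using l_le_\<mu> U1 cube_corners by blast
  ultimately have outer: "l 1 1 \<le> l k 1" "\<mu> k 1 \<le> \<mu> N 1"
    using chain_bounds[of N "\<lambda>j. l j 1" "\<lambda>j. \<mu> j 1"] k(1) by auto
  have inner: "l k 1 \<le> l k t" "\<mu> k t \<le> \<mu> k 1"
    using bounds_mono[OF st(2) cube_corners(2) cube_corners(5)[OF st(2)] k(1)] by auto
  have le: "s \<le> t" using st by simp
  show ?thesis
  proof (rule weighted_integral_strict_mono[OF cdf_\<Phi> conv st(4), where k = k])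
    show "cdf_lower \<Phi> \<le> l k t" "\<mu> k t \<le> cdf_upper \<Phi>"
      using order_trans[OF outer(1) inner(1)] order_trans[OF inner(2) outer(2)] ends by simp_all
  qed (use coeff_mono[OF st(1,2) le] bounds_mono[OF st(1,2) le] l_le_\<mu>[OF st(1) U1] strict[OF st(1-3)] k(1) in blast)+
qed

text \<open>The mirror image: the interval is widest at 0, and \<open>t\<close> carries the smaller
  weight, so positivity is required there.\<close>

lemma \<theta>_part_strict_antimono:
  assumes conv: "convex (cdf_support \<Phi>)"
    and ends: "\<nu> N 0 = cdf_upper \<Phi>" "m 1 0 = cdf_lower \<Phi>"
    and k: "k \<in> {1..N}" "monotone_each (>) (\<nu> k) \<or> monotone_each (<) (m k)"
    and st: "s \<in> {0..1}" "t \<in> {0..1}" "s < t" "\<theta> t > 0"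
  shows "\<theta>_part t < \<theta>_part s"
proof -
  have strict: "m k p < m k q \<or> \<nu> k q < \<nu> k p" if "p \<in> {0..1}" "q \<in> {0..1}" "p < q" for p q
    using k(2) monotone_each_less[of "(<)" "m k" p q] monotone_each_less[of "(>)" "\<nu> k" p q] that
    by auto
  have \<theta>0: "\<theta> 0 \<noteq> 0" using coeff_mono(4)[OF cube_corners(1) st(2) cube_corners(4)[OF st(2)]] st(4) by simp
  have "\<forall>j. 1 \<le> j \<and> j \<le> N - 1 \<longrightarrow> \<nu> j 0 \<le> m (j + 1) 0"
    using \<theta>_chain[OF \<theta>0] strict[OF cube_corners(1-3)] k(1) by blast
  moreover have "\<forall>j\<in>{1..N}. m j 0 \<le> \<nu> j 0" using m_le_\<nu> \<theta>0 cube_corners by blast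
  ultimately have outer: "m 1 0 \<le> m k 0" "\<nu> k 0 \<le> \<nu> N 0"
    using chain_bounds[of N "\<lambda>j. m j 0" "\<lambda>j. \<nu> j 0"] k(1) by auto
  have inner: "m k 0 \<le> m k s" "\<nu> k s \<le> \<nu> k 0"
    using bounds_mono[OF cube_corners(1) st(1) cube_corners(4)[OF st(1)] k(1)] by auto
  have le: "s \<le> t" using st by simp
  show ?thesis
  proof (rule weighted_integral_strict_mono[OF cdf_\<Phi> conv st(4), where k = k])
    show "cdf_lower \<Phi> \<le> m k s" "\<nu> k s \<le> cdf_upper \<Phi>"
      using order_trans[OF outer(1) inner(1)] order_trans[OF inner(2) outer(2)] ends by simp_all
  qed (use coeff_mono[OF st(1,2) le] bounds_mono[OF st(1,2) le] m_le_\<nu>[OF st(2) \<theta>0] strict[OF st(1-3)] k(1) in blast)+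
qed

end

section \<open>The support of the generated function\<close>

text \<open>A left increment of \<open>H\<close> vanishes when all \<open>G i\<close> are flat
  there, and is positive as soon as one of them increases. Strict growth of \<open>K\<close> is
  needed only along the curve \<open>cdf_vec G\<close>.\<close>

lemma cdf_support_compose:
  fixes G :: "'m::finite \<Rightarrow> real \<Rightarrow> real"
  assumes G: "\<forall>i. is_cdf (G i)"
    and H: "\<And>x. H x = K (cdf_vec G x)"
    and K: "\<And>x y. cdf_vec G x < cdf_vec G y \<Longrightarrow> K (cdf_vec G x) < K (cdf_vec G y)"
  shows "cdf_support H = (\<Union>i. cdf_support (G i))"
proof (intro equalityI subsetI)
  note mono = monoD[OF is_cdfD(1)[OF G[rule_format]]]
  fix x
  {
    assume x: "x \<in> cdf_support H"
    show "x \<in> (\<Union>i. cdf_support (G i))"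
    proof (rule ccontr)
      assume "x \<notin> (\<Union>i. cdf_support (G i))"
      then have "\<forall>i. \<exists>e>0. G i x \<le> G i (x - e)"
        by (auto simp: cdf_support_def not_less)
      then obtain e where e: "\<And>i. e i > 0" "\<And>i. G i x \<le> G i (x - e i)" by metis
      \<comment> \<open>Finiteness of the index type gives a common positive length on which all
        \<open>G i\<close> are flat.\<close>
      define d where "d = Min (range e)"
      have "d > 0" "\<And>i. d \<le> e i" using e by (auto simp: d_def)
      then have "G i (x - d) = G i x" for i
        using mono[of "x - e i" "x - d" i] mono[of "x - d" x i] e(2)[of i] by (simp add: order_antisym)
      then have "H (x - d) = H x" by (simp add: H cdf_vec_def)
      then show False using x \<open>d > 0\<close> by (auto simp: cdf_support_def)
    qed
  next
    assume "x \<in> (\<Union>i. cdf_support (G i))"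
    then obtain i where i: "\<forall>e>0. G i (x - e) < G i x" by (auto simp: cdf_support_def)
    have "cdf_vec G (x - e) < cdf_vec G x" if "e > 0" for e
    proof -
      have "cdf_vec G (x - e) \<le> cdf_vec G x"
        using mono that by (auto simp: cdf_vec_def less_eq_vec_def)
      moreover have "cdf_vec G (x - e) $ i < cdf_vec G x $ i"
        using i that by (simp add: cdf_vec_def)
      ultimately show ?thesis by (auto simp: order_less_le)
    qed
    then show "x \<in> cdf_support H" using K by (simp add: cdf_support_def H)
  }
qed

theorem theorem4:
  fixes G :: "'m::finite \<Rightarrow> real \<Rightarrow> real"
    and H \<Phi> :: "real \<Rightarrow> real"
    and N :: nat
    and U \<theta> :: "real ^ 'm \<Rightarrow> real"
    and \<mu> l \<nu> m :: "nat \<Rightarrow> real ^ 'm \<Rightarrow> ereal"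
  assumes G: "\<forall>i. is_cdf (G i)"
    and H: "is_cdf H"
    and gen: "form_A N \<Phi> U \<theta> \<mu> l \<nu> m G \<and> H = generated_A N \<Phi> U \<theta> \<mu> l \<nu> m G \<or>
              form_B N \<Phi> U \<theta> \<mu> l \<nu> m G \<and> H = generated_B N \<Phi> U \<theta> \<mu> l \<nu> m G"
    and f1: "convex (cdf_support \<Phi>)"
    and f2: "(\<mu> N 1 = cdf_upper \<Phi> \<and> l 1 1 = cdf_lower \<Phi> \<and>
               (\<forall>x. U (cdf_vec G x) > 0) \<and>
               (\<exists>j\<in>{1..N}. monotone_each (<) (\<mu> j) \<or> monotone_each (>) (l j))) \<or>
             (\<nu> N 0 = cdf_upper \<Phi> \<and> m 1 0 = cdf_lower \<Phi> \<and>
               (\<forall>x. \<theta> (cdf_vec G x) > 0) \<and>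
               (\<exists>j\<in>{1..N}. monotone_each (>) (\<nu> j) \<or> monotone_each (<) (m j)))"
  shows "cdf_support H = (\<Union>i. cdf_support (G i))"
proof -
  interpret monotone_generator N \<Phi> U \<theta> \<mu> l \<nu> m G
    using gen form_A_monotone_generator form_B_monotone_generator by blast
  \<comment> \<open>The constant is 0 for Form A and 1 for Form B; from here on both forms are
    treated alike.\<close>
  obtain c where Hc: "\<And>x. H x = c + U_part (cdf_vec G x) - \<theta>_part (cdf_vec G x)"
  proof -
    have "(\<forall>x. H x = 0 + U_part (cdf_vec G x) - \<theta>_part (cdf_vec G x)) \<or>
          (\<forall>x. H x = 1 + U_part (cdf_vec G x) - \<theta>_part (cdf_vec G x))"
      using gen by (auto simp: generated_A_def generated_B_def Let_def)
    then show thesis using that by blast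
  qed
  show ?thesis
  proof (rule cdf_support_compose[where K = "\<lambda>s. c + U_part s - \<theta>_part s"])
    fix x y assume less: "cdf_vec G x < cdf_vec G y"
    note cube = cdf_vec_cube[OF G, of x] cdf_vec_cube[OF G, of y]
    have le: "U_part (cdf_vec G x) \<le> U_part (cdf_vec G y)"
      "\<theta>_part (cdf_vec G y) \<le> \<theta>_part (cdf_vec G x)"
      using parts_mono[OF cube] less by auto
    \<comment> \<open>Alternative (a) makes the first part strict and (b) the second; weak
      monotonicity of the other part then suffices.\<close>
    from f2 have "U_part (cdf_vec G x) < U_part (cdf_vec G y) \<or>
      \<theta>_part (cdf_vec G y) < \<theta>_part (cdf_vec G x)"
      using U_part_strict_mono[OF f1 _ _ _ _ cube less] \<theta>_part_strict_antimono[OF f1 _ _ _ _ cube less]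
      by blast
    then show "c + U_part (cdf_vec G x) - \<theta>_part (cdf_vec G x)
      < c + U_part (cdf_vec G y) - \<theta>_part (cdf_vec G y)"
      using le by linarith
  qed (fact G, fact Hc)
qed

end
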